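(* Let $R$ be one of the $s\times s$ matrices ${}^{s}R_{gm}$ ($s\ge 4$ even), ${}^{s}R_{sg}$ ($s$ even), $R_f$ ($s=7$), $R_c$ ($s=8$), ${}^{s}R_{wqh}$ ($s=2p$, $p\ge 1$) defined in the context. Let $G=(V(G),E(G))$ be a $k$-uniform hypergraph with $k\ge 2$, let $C=\{v_1,\dots,v_s\}$ be a subset of $V(G)$ with $|C|=s$, and let $D=V(G)\setminus C$. Assume that for all $r\in\{1,2,\dots,k\}$ and all $A\in\binom{D}{k-r}$ there is an $r$-uniform hypergraph $L_r^A\in\mathcal{B}^r_R$ with vertex set $C$ (whose edge set $E(L_r^A)$ may be empty) such that $$\left\{e\cup A\in E(G): e\in\tbinom{C}{r}\right\}=\{e\cup A: e\in E(L_r^A)\}.$$ Construct a $k$-uniform hypergraph $H$ on the vertex set $V(G)$ from $G$ as follows: for each $r\in\{1,\dots,k\}$ and each $A\in\binom{D}{k-r}$, remove the edges $\{e\cup A: e\in E(L_r^A)\}$ and add the edges $\{e\cup A: e\in E(t(L_r^A))\}$. (Edges of $G$ contained in $D$ are left unchanged.) Then $G$ and $H$ are $E$-cospectral.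
   Context: A $k$-uniform hypergraph is a pair $(V,E)$ with $V$ a finite set and $E\subseteq\binom{V}{k}$; for $k=1$ the edge set is a set of singletons. For $k\ge1$, the adjacency tensor $\mathcal{A}_G$ of a $k$-uniform hypergraph $G$ on $n$ ordered vertices is the order $k$, dimension $n$ array whose $(i_1,\dots,i_k)$ entry is $1$ if $\{i_1,\dots,i_k\}$ is an edge ($k$ distinct vertices) and $0$ otherwise; for $k=1$ it is a zero-one column vector. For an order $k$, dimension $n$ tensor $\mathcal{A}=(a_{j_1\cdots j_k})$ and an $n\times n$ matrix $Q=(q_{ij})$, $Q^\top\mathcal{A}Q$ denotes the order $k$, dimension $n$ tensor with entries $(Q^\top\mathcal{A}Q)_{i_1\cdots i_k}=\sum_{j_1,\dots,j_k\in[n]}a_{j_1\cdots j_k}\,q_{j_1i_1}\cdots q_{j_ki_k}$ (for $k=1$ this is the vector $Q^\top\mathcal{A}$). For $r\ge 1$, $\mathcal{B}^r_R$ is the set of $r$-uniform hypergraphs $L$ on the vertex set $C=\{v_1,\dots,v_s\}$ (with $v_i$ corresponding to index $i$) such that $R^\top\mathcal{A}_LR=\mathcal{A}_{L'}$ for some $r$-uniform hypergraph $L'$ on $C$; this $L'$ is then unique and is denoted $t(L)$. For an order $k\geq 2$ dimension $n$ tensor $\mathcal{A}$ and $x\in\mathbb{C}^n$, $\mathcal{A}x\in\mathbb{C}^n$ is the vector with $(\mathcal{A}x)_i=\sum_{i_2,\dots,i_k\in[n]}a_{i\,i_2\cdots i_k}x_{i_2}\cdots x_{i_k}$. A number $\lambda\in\mathbb{C}$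 is a normalized $E$-eigenvalue of $\mathcal{A}$ if there is $x\in\mathbb{C}^n$ with $\mathcal{A}x=\lambda x$ and $x^\top x=1$. Two $k$-uniform hypergraphs are $E$-cospectral if their adjacency tensors have the same set of normalized $E$-eigenvalues. The matrices. Write $I$, $J$, $O$ for the identity, all-ones and zero matrices (with $I_n,J_n$ of dimension $n$), $Y=2I_2-J_2$, $Z=J_2-I_2$. $\mathrm{circulant}(c_0,\dots,c_{m-1})$ is the (block) circulant matrix with first (block) row $c_0,\dots,c_{m-1}$, i.e. with $(i,j)$ (block) entry $c_{(j-i)\bmod m}$. - ${}^{n}R_{gm}=\frac{2}{n}J_n-I_n$, for even $n\ge 4$. - ${}^{n}R_{sg}=\frac12\,\mathrm{circulant}(J_2,O,\dots,O,Y)$, block circulant with $2\times2$ blocks, of (even) dimension $n$. - $R_f=\frac12\,\mathrm{circulant}(-1,1,1,0,1,0,0)$, of dimension $7$. - $R_c=\frac12\begin{bmatrix}-I&I&I&I\\ I&-Z&I&Z\\ I&Z&-Z&I\\ I&I&Z&-Z\end{bmatrix}$ with $2\times 2$ blocks, of dimension $8$. - ${}^{2p}R_{wqh}=\begin{bmatrix}I_p-\frac1pJ_p&\frac1pJ_p\\ \frac1pJ_p&I_p-\frac1pJ_p\end{bmatrix}$, for $p\ge1$. *)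

theory Defs
  imports "Jordan_Normal_Form.Matrix" "HOL-Library.Ramsey"
    "HOL-Combinatorics.Multiset_Permutations"
begin

definition uniform_hypergraph :: "nat \<Rightarrow> 'a set \<Rightarrow> 'a set set \<Rightarrow> bool" where
  "uniform_hypergraph k V E \<longleftrightarrow> finite V \<and> E \<subseteq> nsets V k"


text \<open>A tensor of order \<open>k\<close> and dimension \<open>n\<close> is a function on index lists of which only the
  values on \<open>tensor_indices k n\<close> matter; indices run over \<open>0, \<dots>, n - 1\<close>.\<close>

type_synonym tensor = "nat list \<Rightarrow> complex"

definition tensor_indices :: "nat \<Rightarrow> nat \<Rightarrow> nat list set" where
  "tensor_indices k n = {is. length is = k \<and> set is \<subseteq> {..<n}}"

definition tensor_eq :: "nat \<Rightarrow> nat \<Rightarrow> tensor \<Rightarrow> tensor \<Rightarrow> bool" where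
  "tensor_eq k n A B \<longleftrightarrow> (\<forall>is \<in> tensor_indices k n. A is = B is)"

text \<open>The list \<open>us\<close> is the ordering of the vertices, \<open>us ! i\<close> being the vertex with index \<open>i\<close>.
  The order \<open>k\<close> of the tensor is the length of the index list.\<close>

definition adjacency_tensor :: "'a list \<Rightarrow> 'a set set \<Rightarrow> tensor" where
  "adjacency_tensor us E is =
     (if distinct is \<and> set (map (\<lambda>i. us ! i) is) \<in> E then 1 else 0)"

text \<open>The tensor \<open>Q\<^sup>T A Q\<close> of order \<open>k\<close> and dimension \<open>n\<close>.\<close>

definition tensor_transform :: "nat \<Rightarrow> nat \<Rightarrow> complex mat \<Rightarrow> tensor \<Rightarrow> tensor" where
  "tensor_transform k n Q A is =
     (\<Sum>js \<in> tensor_indices k n. A js * (\<Prod>l<k. Q $$ (js ! l, is ! l)))"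

definition tensor_vec :: "nat \<Rightarrow> nat \<Rightarrow> tensor \<Rightarrow> complex vec \<Rightarrow> complex vec" where
  "tensor_vec k n A x =
     vec n (\<lambda>i. \<Sum>js \<in> tensor_indices (k - 1) n. A (i # js) * (\<Prod>l<k - 1. x $ (js ! l)))"

text \<open>The product \<open>x \<bullet> x\<close> is the bilinear one, without complex conjugation.\<close>

definition normalized_E_eigenvalue :: "nat \<Rightarrow> nat \<Rightarrow> tensor \<Rightarrow> complex \<Rightarrow> bool" where
  "normalized_E_eigenvalue k n A l \<longleftrightarrow>
     (\<exists>x \<in> carrier_vec n. tensor_vec k n A x = l \<cdot>\<^sub>v x \<and> x \<bullet> x = 1)"

text \<open>The adjacency tensor depends on the ordering of the vertices, so the condition is required
  for all orderings of both vertex sets.\<close>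

definition E_cospectral ::
  "nat \<Rightarrow> 'a set \<Rightarrow> 'a set set \<Rightarrow> 'b set \<Rightarrow> 'b set set \<Rightarrow> bool" where
  "E_cospectral k V E V' E' \<longleftrightarrow>
     (\<forall>us \<in> permutations_of_set V. \<forall>us' \<in> permutations_of_set V'.
        {l. normalized_E_eigenvalue k (card V) (adjacency_tensor us E) l} =
        {l. normalized_E_eigenvalue k (card V') (adjacency_tensor us' E') l})"


definition ones_mat :: "nat \<Rightarrow> complex mat" where
  "ones_mat n = mat n n (\<lambda>_. 1)"

definition Y_mat :: "complex mat" where
  "Y_mat = 2 \<cdot>\<^sub>m 1\<^sub>m 2 - ones_mat 2"

definition Z_mat :: "complex mat" where
  "Z_mat = ones_mat 2 - 1\<^sub>m 2"

text \<open>Square matrix assembled from a square array of \<open>b \<times> b\<close> blocks, given as a list of block rows.\<close>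

definition block_mat :: "nat \<Rightarrow> complex mat list list \<Rightarrow> complex mat" where
  "block_mat b Bs = mat (b * length Bs) (b * length Bs)
     (\<lambda>(i, j). (Bs ! (i div b) ! (j div b)) $$ (i mod b, j mod b))"

definition circulant_entry :: "'c list \<Rightarrow> nat \<Rightarrow> nat \<Rightarrow> 'c" where
  "circulant_entry cs i j = cs ! nat ((int j - int i) mod int (length cs))"

definition circulant :: "complex list \<Rightarrow> complex mat" where
  "circulant cs = mat (length cs) (length cs) (\<lambda>(i, j). circulant_entry cs i j)"

definition block_circulant :: "nat \<Rightarrow> complex mat list \<Rightarrow> complex mat" where
  "block_circulant b Cs = block_mat b
     (map (\<lambda>i. map (\<lambda>j. circulant_entry Cs i j) [0..<length Cs]) [0..<length Cs])"

definition R_gm :: "nat \<Rightarrow> complex mat" where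
  "R_gm n = (2 / of_nat n) \<cdot>\<^sub>m ones_mat n - 1\<^sub>m n"

text \<open>The first block row has \<open>n / 2\<close> blocks and contains both \<open>J\<close> and \<open>Y\<close>, so \<open>R_sg n\<close> is meaningful
  only for even \<open>n \<ge> 4\<close>.\<close>

definition R_sg :: "nat \<Rightarrow> complex mat" where
  "R_sg n = (1 / 2) \<cdot>\<^sub>m
     block_circulant 2 ([ones_mat 2] @ replicate (n div 2 - 2) (0\<^sub>m 2 2) @ [Y_mat])"

definition R_f :: "complex mat" where
  "R_f = (1 / 2) \<cdot>\<^sub>m circulant [-1, 1, 1, 0, 1, 0, 0]"

definition R_c :: "complex mat" where
  "R_c = (1 / 2) \<cdot>\<^sub>m block_mat 2
     [[- 1\<^sub>m 2, 1\<^sub>m 2, 1\<^sub>m 2, 1\<^sub>m 2],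
      [1\<^sub>m 2, - Z_mat, 1\<^sub>m 2, Z_mat],
      [1\<^sub>m 2, Z_mat, - Z_mat, 1\<^sub>m 2],
      [1\<^sub>m 2, 1\<^sub>m 2, Z_mat, - Z_mat]]"

text \<open>\<open>R_wqh p\<close> has dimension \<open>2 * p\<close>.\<close>

definition R_wqh :: "nat \<Rightarrow> complex mat" where
  "R_wqh p = (let P = (1 / of_nat p) \<cdot>\<^sub>m ones_mat p
     in four_block_mat (1\<^sub>m p - P) P P (1\<^sub>m p - P))"


text \<open>Hypergraphs on \<open>C\<close>, with \<open>vs\<close> the list \<open>v\<^sub>1, \<dots>, v\<^sub>s\<close> of the elements of \<open>C\<close>, are given by
  their edge sets. \<open>switches_to R vs r L L'\<close> states that \<open>R\<^sup>T A\<^sub>L R = A\<^sub>L\<^sub>'\<close>.\<close>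

definition switches_to ::
  "complex mat \<Rightarrow> 'a list \<Rightarrow> nat \<Rightarrow> 'a set set \<Rightarrow> 'a set set \<Rightarrow> bool" where
  "switches_to R vs r L L' \<longleftrightarrow>
     tensor_eq r (length vs)
       (tensor_transform r (length vs) R (adjacency_tensor vs L)) (adjacency_tensor vs L')"

definition switchable :: "complex mat \<Rightarrow> 'a list \<Rightarrow> nat \<Rightarrow> 'a set set set" where
  "switchable R vs r =
     {L. uniform_hypergraph r (set vs) L \<and>
         (\<exists>L'. uniform_hypergraph r (set vs) L' \<and> switches_to R vs r L L')}"

definition switched :: "complex mat \<Rightarrow> 'a list \<Rightarrow> nat \<Rightarrow> 'a set set \<Rightarrow> 'a set set" where
  "switched R vs r L =
     (THE L'. uniform_hypergraph r (set vs) L' \<and> switches_to R vs r L L')"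

text \<open>The sets of edges treated for different pairs \<open>(r, A)\<close> are disjoint, since an edge \<open>f\<close> belongs to
  the pair \<open>(card (f \<inter> C), f - C)\<close>; hence all removals and additions are done at once.\<close>

definition switched_edges ::
  "complex mat \<Rightarrow> 'a list \<Rightarrow> nat \<Rightarrow> 'a set \<Rightarrow> (nat \<Rightarrow> 'a set \<Rightarrow> 'a set set) \<Rightarrow> 'a set set
     \<Rightarrow> 'a set set" where
  "switched_edges R vs k D L E =
     (E - (\<Union>r \<in> {1..k}. \<Union>A \<in> nsets D (k - r). {e \<union> A |e. e \<in> L r A}))
       \<union> (\<Union>r \<in> {1..k}. \<Union>A \<in> nsets D (k - r). {e \<union> A |e. e \<in> switched R vs r (L r A)})"

end

theory Submission
  imports Defs "Jordan_Normal_Form.Determinant"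
begin

text \<open>Extend \<open>R\<close> by the identity on \<open>D\<close> to an orthogonal matrix \<open>Q\<close> on \<open>V\<close>. Splitting an index tuple of
  \<open>Q\<^sup>T A\<^sub>G Q\<close> into its part in \<open>C\<close> and its part \<open>A\<close> in \<open>D\<close> leaves the tensor \<open>R\<^sup>T A\<^sub>L R\<close> for
  \<open>L = L r A\<close>, so \<open>Q\<^sup>T A\<^sub>G Q = A\<^sub>H\<close>. An orthogonal change of variables \<open>x \<mapsto> Q\<^sup>T x\<close> then carries normalized
  E-eigenvectors to normalized E-eigenvectors. Indexing tensors by the vertices themselves makes
  both the splitting and the independence of the vertex ordering immediate.\<close>

section \<open>Tensors indexed by vertices\<close>

definition tuples :: "'a set \<Rightarrow> nat \<Rightarrow> 'a list set" where
  "tuples V k = {xs. length xs = k \<and> set xs \<subseteq> V}"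

definition vertex_tensor :: "'a set set \<Rightarrow> 'a list \<Rightarrow> complex" where
  "vertex_tensor E xs = (if distinct xs \<and> set xs \<in> E then 1 else 0)"

text \<open>The order is taken from the length of the argument, so one constant covers order
  \<open>k\<close> on \<open>V\<close> and every order \<open>r\<close> on \<open>C\<close>.\<close>

definition vertex_transform ::
  "'a set \<Rightarrow> ('a \<Rightarrow> 'a \<Rightarrow> complex) \<Rightarrow> ('a list \<Rightarrow> complex) \<Rightarrow> 'a list \<Rightarrow> complex" where
  "vertex_transform V Q T xs =
     (\<Sum>ys \<in> tuples V (length xs). T ys * prod_list (map2 Q ys xs))"

text \<open>Here \<open>k\<close> counts the contracted slots, one less than the order of the
  tensor; hence the \<open>k - 1\<close> in \<open>vertex_eigenvalue\<close>.\<close>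

definition contract ::
  "'a set \<Rightarrow> nat \<Rightarrow> ('a list \<Rightarrow> complex) \<Rightarrow> ('a \<Rightarrow> complex) \<Rightarrow> 'a \<Rightarrow> complex" where
  "contract V k T f v = (\<Sum>ys \<in> tuples V k. T (v # ys) * prod_list (map f ys))"

definition vertex_eigenvalue ::
  "'a set \<Rightarrow> nat \<Rightarrow> ('a list \<Rightarrow> complex) \<Rightarrow> complex \<Rightarrow> bool" where
  "vertex_eigenvalue V k T l \<longleftrightarrow>
     (\<exists>f. (\<forall>v\<in>V. contract V (k - 1) T f v = l * f v) \<and> (\<Sum>v\<in>V. f v * f v) = 1)"

text \<open>Both \<open>Q Q^T = I\<close> and \<open>Q^T Q = I\<close> on \<open>V\<close> are
  recorded, which makes the notion visibly invariant under transposition.\<close>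

definition orthogonal_on :: "'a set \<Rightarrow> ('a \<Rightarrow> 'a \<Rightarrow> complex) \<Rightarrow> bool" where
  "orthogonal_on V Q \<longleftrightarrow>
     (\<forall>v\<in>V. \<forall>w\<in>V. (\<Sum>u\<in>V. Q v u * Q w u) = of_bool (v = w)) \<and>
     (\<forall>v\<in>V. \<forall>w\<in>V. (\<Sum>u\<in>V. Q u v * Q u w) = of_bool (v = w))"

lemma tuples_0 [simp]: "tuples V 0 = {[]}"
  by (auto simp: tuples_def)

lemma sum_tuples_Suc:
  "sum f (tuples V (Suc k)) = (\<Sum>v\<in>V. \<Sum>xs\<in>tuples V k. f (v # xs))"
proof -
  have "sum f (tuples V (Suc k)) = sum (\<lambda>(v, xs). f (v # xs)) (V \<times> tuples V k)"
    by (rule sum.reindex_bij_witness[where i = "\<lambda>(v, xs). v # xs" and j = "\<lambda>xs. (hd xs, tl xs)"])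
      (auto simp: tuples_def length_Suc_conv)
  then show ?thesis
    by (simp add: sum.cartesian_product)
qed

text \<open>The slots of \<open>xs\<close> are summed independently, so distributivity gives one
  factor \<open>(Q g) y\<close> per entry \<open>y\<close> of \<open>ys\<close>.\<close>

lemma sum_tuples_map2:
  "(\<Sum>xs\<in>tuples V (length ys). prod_list (map2 Q ys xs) * prod_list (map g xs))
     = prod_list (map (\<lambda>y. \<Sum>x\<in>V. Q y x * g x) ys)"
  for Q :: "'b \<Rightarrow> 'a \<Rightarrow> complex"
proof (induction ys)
  case (Cons y ys)
  have "(\<Sum>xs\<in>tuples V (length (y # ys)). prod_list (map2 Q (y # ys) xs) * prod_list (map g xs))
      = (\<Sum>v\<in>V. \<Sum>xs\<in>tuples V (length ys).
           (Q y v * g v) * (prod_list (map2 Q ys xs) * prod_list (map g xs)))"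
    by (simp add: sum_tuples_Suc mult_ac)
  also have "\<dots> = (\<Sum>v\<in>V. Q y v * g v) * prod_list (map (\<lambda>y. \<Sum>x\<in>V. Q y x * g x) ys)"
    by (simp only: sum_distrib_left[symmetric] sum_distrib_right[symmetric] Cons.IH)
  finally show ?case by simp
qed simp

text \<open>In matrix notation \<open>(Q^T T Q) g = Q^T (T (Q g))\<close>: the free slot supplies
  \<open>Q^T\<close>, and after exchanging the sums the other \<open>k\<close> slots absorb
  \<open>g\<close> by \<open>sum_tuples_map2\<close>.\<close>

lemma contract_transform:
  "contract V k (vertex_transform V Q T) g v =
     (\<Sum>u\<in>V. Q u v * contract V k T (\<lambda>y. \<Sum>x\<in>V. Q y x * g x) u)"
proof -
  have "contract V k (vertex_transform V Q T) g v =
     (\<Sum>xs\<in>tuples V k. \<Sum>u\<in>V. \<Sum>ys\<in>tuples V k.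
        Q u v * (T (u # ys) * (prod_list (map2 Q ys xs) * prod_list (map g xs))))"
    unfolding contract_def vertex_transform_def
  proof (intro sum.cong refl)
    fix xs assume "xs \<in> tuples V k"
    then have "length xs = k" by (simp add: tuples_def)
    then show "(\<Sum>ys\<in>tuples V (length (v # xs)). T ys * prod_list (map2 Q ys (v # xs))) *
        prod_list (map g xs) = (\<Sum>u\<in>V. \<Sum>ys\<in>tuples V k.
        Q u v * (T (u # ys) * (prod_list (map2 Q ys xs) * prod_list (map g xs))))"
      by (simp add: sum_tuples_Suc sum_distrib_left sum_distrib_right mult_ac)
  qed
  also have "\<dots> = (\<Sum>u\<in>V. \<Sum>ys\<in>tuples V k. \<Sum>xs\<in>tuples V k.
        Q u v * (T (u # ys) * (prod_list (map2 Q ys xs) * prod_list (map g xs))))"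
    by (subst sum.swap) (rule sum.cong, simp, subst sum.swap, simp)
  also have "\<dots> = (\<Sum>u\<in>V. Q u v * contract V k T (\<lambda>y. \<Sum>x\<in>V. Q y x * g x) u)"
    unfolding contract_def sum_distrib_left
  proof (intro sum.cong refl)
    fix u ys assume "ys \<in> tuples V k"
    then have "k = length ys" by (simp add: tuples_def)
    then show "(\<Sum>xs\<in>tuples V k.
        Q u v * (T (u # ys) * (prod_list (map2 Q ys xs) * prod_list (map g xs)))) =
        Q u v * (T (u # ys) * prod_list (map (\<lambda>y. \<Sum>x\<in>V. Q y x * g x) ys))"
      by (simp only: sum_distrib_left[symmetric] sum_tuples_map2)
  qed
  finally show ?thesis .
qed

lemma contract_cong:
  assumes "\<And>ys. ys \<in> tuples V k \<Longrightarrow> S (v # ys) = T (v # ys)" and "\<And>x. x \<in> V \<Longrightarrow> f x = g x"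
  shows "contract V k S f v = contract V k T g v"
  unfolding contract_def
proof (rule sum.cong)
  fix ys assume ys: "ys \<in> tuples V k"
  then have "map f ys = map g ys"
    using assms(2) by (auto simp: tuples_def)
  then show "S (v # ys) * prod_list (map f ys) = T (v # ys) * prod_list (map g ys)"
    by (simp only: assms(1)[OF ys])
qed simp

text \<open>\<open>P Q^T = I\<close>, read in row \<open>v\<close> alone, gives
  \<open>P (Q^T f) = f\<close> at \<open>v\<close>.\<close>

lemma sum_inverse_pair:
  fixes P Q :: "'a \<Rightarrow> 'a \<Rightarrow> complex"
  assumes "finite V" "v \<in> V"
    and "\<And>w. w \<in> V \<Longrightarrow> (\<Sum>u\<in>V. P v u * Q w u) = of_bool (v = w)"
  shows "(\<Sum>u\<in>V. P v u * (\<Sum>w\<in>V. Q w u * f w)) = f v"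
proof -
  have "(\<Sum>u\<in>V. P v u * (\<Sum>w\<in>V. Q w u * f w)) = (\<Sum>w\<in>V. (\<Sum>u\<in>V. P v u * Q w u) * f w)"
    by (subst sum_distrib_left, subst sum.swap) (simp add: sum_distrib_left sum_distrib_right mult_ac)
  also have "\<dots> = (\<Sum>w\<in>V. if w = v then f w else 0)"
    by (rule sum.cong) (use assms in auto)
  finally show ?thesis using assms by simp
qed

text \<open>\<open>(Q^T f)^T (Q^T f) = f^T (Q Q^T f) = f^T f\<close>.\<close>

lemma sum_squares_orthogonal:
  fixes Q :: "'a \<Rightarrow> 'a \<Rightarrow> complex"
  assumes "finite V"
    and "\<And>v w. v \<in> V \<Longrightarrow> w \<in> V \<Longrightarrow> (\<Sum>u\<in>V. Q v u * Q w u) = of_bool (v = w)"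
  shows "(\<Sum>x\<in>V. (\<Sum>u\<in>V. Q u x * f u) * (\<Sum>u\<in>V. Q u x * f u)) = (\<Sum>u\<in>V. f u * f u)"
proof -
  have "(\<Sum>x\<in>V. (\<Sum>u\<in>V. Q u x * f u) * (\<Sum>u\<in>V. Q u x * f u))
      = (\<Sum>x\<in>V. \<Sum>v\<in>V. f v * (Q v x * (\<Sum>u\<in>V. Q u x * f u)))"
    by (rule sum.cong) (simp_all add: sum_distrib_right mult_ac)
  also have "\<dots> = (\<Sum>v\<in>V. f v * (\<Sum>x\<in>V. Q v x * (\<Sum>u\<in>V. Q u x * f u)))"
    by (subst sum.swap) (simp only: sum_distrib_left)
  also have "\<dots> = (\<Sum>v\<in>V. f v * f v)"
    by (intro sum.cong refl arg_cong2[where f = "(*)"] sum_inverse_pair) (use assms in auto)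
  finally show ?thesis .
qed

lemma vertex_eigenvalue_transform:
  assumes V: "finite V" and Q: "orthogonal_on V Q" and k: "k \<ge> 1"
    and S: "\<And>xs. xs \<in> tuples V k \<Longrightarrow> S xs = vertex_transform V Q T xs"
  shows "vertex_eigenvalue V k T l \<longleftrightarrow> vertex_eigenvalue V k S l"
proof -
  have rows: "\<And>v w. v \<in> V \<Longrightarrow> w \<in> V \<Longrightarrow> (\<Sum>u\<in>V. Q v u * Q w u) = of_bool (v = w)"
    and cols: "\<And>v w. v \<in> V \<Longrightarrow> w \<in> V \<Longrightarrow> (\<Sum>u\<in>V. Q u v * Q u w) = of_bool (v = w)"
    using Q by (auto simp: orthogonal_on_def)
  have S_contract: "contract V (k - 1) S g v =
      (\<Sum>u\<in>V. Q u v * contract V (k - 1) T (\<lambda>y. \<Sum>x\<in>V. Q y x * g x) u)" if "v \<in> V" for g v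
    unfolding contract_transform[symmetric]
    by (rule contract_cong) (use S that k in \<open>auto simp: tuples_def\<close>)
  show ?thesis
  proof
    assume "vertex_eigenvalue V k T l"
    then obtain f where f: "\<And>v. v \<in> V \<Longrightarrow> contract V (k - 1) T f v = l * f v"
      and norm: "(\<Sum>v\<in>V. f v * f v) = 1"
      by (auto simp: vertex_eigenvalue_def)
    \<comment> \<open>\<open>g = Q^T f\<close>; row orthogonality gives \<open>Q g = f\<close>,
      hence \<open>S g = Q^T (T f) = l g\<close>.\<close>
    define g where "g x = (\<Sum>u\<in>V. Q u x * f u)" for x
    have inv: "(\<Sum>x\<in>V. Q y x * g x) = f y" if "y \<in> V" for y
      unfolding g_def using sum_inverse_pair[where P = Q and Q = Q, OF V that rows[OF that]] by simp
    have "contract V (k - 1) S g v = l * g v" if "v \<in> V" for v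
    proof -
      have "contract V (k - 1) S g v = (\<Sum>u\<in>V. Q u v * contract V (k - 1) T f u)"
        unfolding S_contract[OF that]
        by (intro sum.cong refl arg_cong2[where f = "(*)"] contract_cong) (use inv in auto)
      also have "\<dots> = (\<Sum>u\<in>V. Q u v * (l * f u))"
        by (intro sum.cong refl arg_cong2[where f = "(*)"] f)
      finally show ?thesis by (simp add: g_def sum_distrib_left mult_ac)
    qed
    moreover have "(\<Sum>v\<in>V. g v * g v) = 1"
      unfolding g_def using sum_squares_orthogonal[OF V rows] norm by simp
    ultimately show "vertex_eigenvalue V k S l"
      by (auto simp: vertex_eigenvalue_def)
  next
    assume "vertex_eigenvalue V k S l"
    then obtain g where g: "\<And>v. v \<in> V \<Longrightarrow> contract V (k - 1) S g v = l * g v"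
      and norm: "(\<Sum>v\<in>V. g v * g v) = 1"
      by (auto simp: vertex_eigenvalue_def)
    define f where "f = (\<lambda>y. \<Sum>x\<in>V. Q y x * g x)"
    have "contract V (k - 1) T f v = l * f v" if "v \<in> V" for v
    proof -
      \<comment> \<open>\<open>T f = Q Q^T (T f)\<close> by row orthogonality, and
        \<open>Q^T (T (Q g)) = S g\<close> by \<open>S_contract\<close>.\<close>
      have "contract V (k - 1) T f v
          = (\<Sum>x\<in>V. Q v x * (\<Sum>u\<in>V. Q u x * contract V (k - 1) T f u))"
        using sum_inverse_pair[where P = Q and Q = Q and f = "contract V (k - 1) T f", OF V that rows[OF that]]
        by simp
      also have "\<dots> = (\<Sum>x\<in>V. Q v x * (l * g x))"
        by (intro sum.cong refl arg_cong2[where f = "(*)"])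
          (use S_contract[of _ g] g in \<open>simp_all add: f_def\<close>)
      finally show ?thesis by (simp add: f_def sum_distrib_left mult_ac)
    qed
    moreover have "(\<Sum>v\<in>V. f v * f v) = 1"
      unfolding f_def using sum_squares_orthogonal[OF V, of "\<lambda>x y. Q y x"] cols norm by simp
    ultimately show "vertex_eigenvalue V k T l"
      by (auto simp: vertex_eigenvalue_def)
  qed
qed


section \<open>Orderings of the vertices\<close>

lemma bij_betw_map_nth_tuples:
  assumes "distinct us"
  shows "bij_betw (map ((!) us)) (tensor_indices k (length us)) (tuples (set us) k)"
proof (rule bij_betw_imageI)
  have "bij_betw ((!) us) {..<length us} (set us)"
    using assms by (intro bij_betw_nth) auto
  then have inj: "inj_on ((!) us) {..<length us}" and img: "(!) us ` {..<length us} = set us"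
    by (auto simp: bij_betw_def)
  show "inj_on (map ((!) us)) (tensor_indices k (length us))"
  proof (rule inj_onI)
    fix xs ys assume "xs \<in> tensor_indices k (length us)" "ys \<in> tensor_indices k (length us)"
      and eq: "map ((!) us) xs = map ((!) us) ys"
    then have "set xs \<union> set ys \<subseteq> {..<length us}"
      by (auto simp: tensor_indices_def)
    then show "xs = ys"
      by (rule map_inj_on[OF eq inj_on_subset[OF inj]])
  qed
  have "lists (set us) = map ((!) us) ` lists {..<length us}"
    by (simp only: img[symmetric] lists_image)
  moreover have "tuples (set us) k = {xs \<in> lists (set us). length xs = k}"
    and "tensor_indices k (length us) = {xs \<in> lists {..<length us}. length xs = k}"
    by (auto simp: tuples_def tensor_indices_def)
  ultimately show "map ((!) us) ` tensor_indices k (length us) = tuples (set us) k"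
    by auto
qed

lemma prod_nth_conv_prod_list:
  "(\<Prod>l<n. f (xs ! l)) = prod_list (map f xs)" if "length xs = n" for f :: "'a \<Rightarrow> complex"
  using that by (simp add: prod.list_conv_set_nth atLeast0LessThan)

lemma adjacency_tensor_conv:
  assumes "distinct us" "set is \<subseteq> {..<length us}"
  shows "adjacency_tensor us E is = vertex_tensor E (map ((!) us) is)"
proof -
  have "inj_on ((!) us) (set is)"
    using assms by (intro inj_on_nth) auto
  then show ?thesis
    by (simp add: adjacency_tensor_def vertex_tensor_def distinct_map)
qed

lemma tensor_vec_conv:
  assumes us: "distinct us" and i: "i < length us" and x: "\<And>j. j < length us \<Longrightarrow> x $ j = f (us ! j)"
  shows "tensor_vec k (length us) (adjacency_tensor us E) x $ i =
    contract (set us) (k - 1) (vertex_tensor E) f (us ! i)"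
proof -
  have "tensor_vec k (length us) (adjacency_tensor us E) x $ i =
     (\<Sum>js\<in>tensor_indices (k - 1) (length us).
        vertex_tensor E (us ! i # map ((!) us) js) * prod_list (map f (map ((!) us) js)))"
    unfolding tensor_vec_def index_vec[OF i]
  proof (intro sum.cong refl arg_cong2[where f = "(*)"])
    fix js assume js: "js \<in> tensor_indices (k - 1) (length us)"
    then show "adjacency_tensor us E (i # js) = vertex_tensor E (us ! i # map ((!) us) js)"
      using adjacency_tensor_conv[OF us, of "i # js"] i by (simp add: tensor_indices_def)
    have "(\<Prod>l<k - 1. x $ (js ! l)) = prod_list (map (($) x) js)"
      using js by (intro prod_nth_conv_prod_list) (simp add: tensor_indices_def)
    also have "map (($) x) js = map f (map ((!) us) js)"
      using js x by (auto simp: tensor_indices_def)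
    finally show "(\<Prod>l<k - 1. x $ (js ! l)) = prod_list (map f (map ((!) us) js))" .
  qed
  also have "\<dots> = contract (set us) (k - 1) (vertex_tensor E) f (us ! i)"
    unfolding contract_def by (rule sum.reindex_bij_betw[OF bij_betw_map_nth_tuples[OF us]])
  finally show ?thesis .
qed

text \<open>The right-hand side does not depend on the order of \<open>us\<close>; this is what lets
  \<open>E_cospectral\<close> compare arbitrary orderings.\<close>

lemma normalized_E_eigenvalue_conv:
  assumes us: "distinct us"
  shows "normalized_E_eigenvalue k (length us) (adjacency_tensor us E) l \<longleftrightarrow>
    vertex_eigenvalue (set us) k (vertex_tensor E) l"
proof -
  let ?n = "length us"
  have bij: "bij_betw ((!) us) {..<?n} (set us)"
    using us by (intro bij_betw_nth) auto
  have eig: "tensor_vec k ?n (adjacency_tensor us E) x = l \<cdot>\<^sub>v x \<longleftrightarrow>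
        (\<forall>v\<in>set us. contract (set us) (k - 1) (vertex_tensor E) f v = l * f v)"
    and norm: "x \<bullet> x = (\<Sum>v\<in>set us. f v * f v)"
    if x: "x \<in> carrier_vec ?n" "\<And>j. j < ?n \<Longrightarrow> x $ j = f (us ! j)" for x f
  proof -
    have "tensor_vec k ?n (adjacency_tensor us E) x = l \<cdot>\<^sub>v x \<longleftrightarrow>
        (\<forall>i<?n. tensor_vec k ?n (adjacency_tensor us E) x $ i = l * f (us ! i))"
      using x by (auto simp: vec_eq_iff tensor_vec_def)
    also have "\<dots> \<longleftrightarrow>
        (\<forall>i<?n. contract (set us) (k - 1) (vertex_tensor E) f (us ! i) = l * f (us ! i))"
      using tensor_vec_conv[OF us _ x(2)] by auto
    finally show "tensor_vec k ?n (adjacency_tensor us E) x = l \<cdot>\<^sub>v x \<longleftrightarrow>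
        (\<forall>v\<in>set us. contract (set us) (k - 1) (vertex_tensor E) f v = l * f v)"
      by (simp add: all_set_conv_all_nth)
    have "x \<bullet> x = (\<Sum>i<?n. f (us ! i) * f (us ! i))"
      using x by (auto simp: scalar_prod_def atLeast0LessThan intro!: sum.cong)
    also have "\<dots> = (\<Sum>v\<in>set us. f v * f v)"
      by (rule sum.reindex_bij_betw[OF bij])
    finally show "x \<bullet> x = (\<Sum>v\<in>set us. f v * f v)" .
  qed
  show ?thesis
  proof
    assume "normalized_E_eigenvalue k ?n (adjacency_tensor us E) l"
    then obtain x where x: "x \<in> carrier_vec ?n"
      and *: "tensor_vec k ?n (adjacency_tensor us E) x = l \<cdot>\<^sub>v x" "x \<bullet> x = 1"
      by (auto simp: normalized_E_eigenvalue_def)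
    \<comment> \<open>Coordinates are carried to vertices by the inverse of the enumeration; only
      the values on \<open>set us\<close> matter.\<close>
    define f where "f v = x $ the_inv_into {..<?n} ((!) us) v" for v
    have "x $ j = f (us ! j)" if "j < ?n" for j
      unfolding f_def using bij that by (subst the_inv_into_f_f) (auto simp: bij_betw_def)
    then show "vertex_eigenvalue (set us) k (vertex_tensor E) l"
      using eig[OF x] norm[OF x] * unfolding vertex_eigenvalue_def by metis
  next
    assume "vertex_eigenvalue (set us) k (vertex_tensor E) l"
    then obtain f where
      f: "\<forall>v\<in>set us. contract (set us) (k - 1) (vertex_tensor E) f v = l * f v"
        "(\<Sum>v\<in>set us. f v * f v) = 1"
      by (auto simp: vertex_eigenvalue_def)
    show "normalized_E_eigenvalue k ?n (adjacency_tensor us E) l"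
      unfolding normalized_E_eigenvalue_def
      by (rule bexI[of _ "vec ?n (\<lambda>i. f (us ! i))"]) (use f eig norm in auto)
  qed
qed

lemma E_cospectralI:
  assumes "\<And>l. vertex_eigenvalue V k (vertex_tensor E) l \<longleftrightarrow> vertex_eigenvalue V k (vertex_tensor H) l"
  shows "E_cospectral k V E V H"
  unfolding E_cospectral_def
proof (intro ballI)
  fix us us' assume "us \<in> permutations_of_set V" "us' \<in> permutations_of_set V"
  then have us: "distinct us" "set us = V" "length us = card V"
    and us': "distinct us'" "set us' = V" "length us' = card V"
    by (auto simp: permutations_of_set_def simp flip: distinct_card)
  show "{l. normalized_E_eigenvalue k (card V) (adjacency_tensor us E) l} =
      {l. normalized_E_eigenvalue k (card V) (adjacency_tensor us' H) l}"
    using assms normalized_E_eigenvalue_conv[OF us(1), of k E]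
      normalized_E_eigenvalue_conv[OF us'(1), of k H] us us' by simp
qed

text \<open>Junk outside \<open>set vs\<close>: the index of a foreign vertex is unspecified.\<close>

definition mat_on :: "'a list \<Rightarrow> complex mat \<Rightarrow> 'a \<Rightarrow> 'a \<Rightarrow> complex" where
  "mat_on vs R v w =
     R $$ (the_inv_into {..<length vs} ((!) vs) v, the_inv_into {..<length vs} ((!) vs) w)"

lemma mat_on_nth:
  assumes "distinct vs" "i < length vs" "j < length vs"
  shows "mat_on vs R (vs ! i) (vs ! j) = R $$ (i, j)"
proof -
  have "inj_on ((!) vs) {..<length vs}"
    using assms by (auto simp: inj_on_def nth_eq_iff_index_eq)
  then show ?thesis
    using assms by (simp add: mat_on_def the_inv_into_f_f)
qed

lemma tensor_transform_conv:
  assumes vs: "distinct vs" and "is": "is \<in> tensor_indices r (length vs)"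
  shows "tensor_transform r (length vs) R (adjacency_tensor vs L) is =
    vertex_transform (set vs) (mat_on vs R) (vertex_tensor L) (map ((!) vs) is)"
proof -
  have "tensor_transform r (length vs) R (adjacency_tensor vs L) is =
     (\<Sum>js\<in>tensor_indices r (length vs). vertex_tensor L (map ((!) vs) js) *
        prod_list (map2 (mat_on vs R) (map ((!) vs) js) (map ((!) vs) is)))"
    unfolding tensor_transform_def
  proof (intro sum.cong refl arg_cong2[where f = "(*)"])
    fix js assume js: "js \<in> tensor_indices r (length vs)"
    then show "adjacency_tensor vs L js = vertex_tensor L (map ((!) vs) js)"
      by (intro adjacency_tensor_conv[OF vs]) (simp add: tensor_indices_def)
    have "set is \<subseteq> {..<length vs}" "set js \<subseteq> {..<length vs}" "length is = r" "length js = r"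
      using "is" js by (auto simp: tensor_indices_def)
    then have "is ! l < length vs" "js ! l < length vs" if "l < r" for l
      using that by (metis lessThan_iff nth_mem subsetD)+
    then show "(\<Prod>l<r. R $$ (js ! l, is ! l)) =
        prod_list (map2 (mat_on vs R) (map ((!) vs) js) (map ((!) vs) is))"
      using "is" js
      by (auto simp: tensor_indices_def prod.list_conv_set_nth atLeast0LessThan mat_on_nth[OF vs]
          intro!: prod.cong)
  qed
  also have "\<dots> = vertex_transform (set vs) (mat_on vs R) (vertex_tensor L) (map ((!) vs) is)"
    using "is" sum.reindex_bij_betw[OF bij_betw_map_nth_tuples[OF vs, of r], of
        "\<lambda>ys. vertex_tensor L ys * prod_list (map2 (mat_on vs R) ys (map ((!) vs) is))"]
    by (simp add: vertex_transform_def tensor_indices_def)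
  finally show ?thesis .
qed

lemma switches_to_iff:
  assumes vs: "distinct vs"
  shows "switches_to R vs r L L' \<longleftrightarrow> (\<forall>xs\<in>tuples (set vs) r.
    vertex_transform (set vs) (mat_on vs R) (vertex_tensor L) xs = vertex_tensor L' xs)"
proof -
  have "tuples (set vs) r = map ((!) vs) ` tensor_indices r (length vs)"
    using bij_betw_map_nth_tuples[OF vs, of r] by (simp add: bij_betw_def)
  then show ?thesis
    using tensor_transform_conv[OF vs] adjacency_tensor_conv[OF vs]
    by (auto simp: switches_to_def tensor_eq_def tensor_indices_def)
qed

text \<open>Every \<open>r\<close>-set can be listed as a repetition-free tuple, at which the tensor
  reads off membership.\<close>

lemma vertex_tensor_inject:
  assumes "uniform_hypergraph r V L" "uniform_hypergraph r V L'"
    and "\<And>xs. xs \<in> tuples V r \<Longrightarrow> vertex_tensor L xs = vertex_tensor L' xs"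
  shows "L = L'"
proof -
  have "e \<in> L \<longleftrightarrow> e \<in> L'" if "e \<in> nsets V r" for e
  proof -
    have e: "finite e" "card e = r" "e \<subseteq> V"
      using that by (auto simp: nsets_def)
    then obtain xs where xs: "set xs = e" "distinct xs"
      using finite_distinct_list by blast
    then have "xs \<in> tuples V r"
      using e distinct_card by (force simp: tuples_def)
    from assms(3)[OF this] xs show ?thesis
      by (simp add: vertex_tensor_def split: if_splits)
  qed
  then show ?thesis
    using assms(1,2) by (auto simp: uniform_hypergraph_def)
qed

text \<open>Membership in \<open>switchable\<close> provides existence and
  \<open>vertex_tensor_inject\<close> uniqueness, so the definite description in
  \<open>switched\<close> is well defined.\<close>

lemma switched_switchable:
  assumes vs: "distinct vs" and L: "L \<in> switchable R vs r"
  shows "uniform_hypergraph r (set vs) (switched R vs r L)" (is ?A)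
    and "switches_to R vs r L (switched R vs r L)" (is ?B)
proof -
  obtain L' where L': "uniform_hypergraph r (set vs) L' \<and> switches_to R vs r L L'"
    using L by (auto simp: switchable_def)
  have "?A \<and> ?B"
    unfolding switched_def
  proof (rule theI[where P = "\<lambda>L'. uniform_hypergraph r (set vs) L' \<and> switches_to R vs r L L'"])
    show "uniform_hypergraph r (set vs) L' \<and> switches_to R vs r L L'" by (fact L')
  next
    fix M assume "uniform_hypergraph r (set vs) M \<and> switches_to R vs r L M"
    with L' show "M = L'"
      by (intro vertex_tensor_inject[of r "set vs"]) (auto simp: switches_to_iff[OF vs])
  qed
  then show ?A ?B by auto
qed


section \<open>The switching matrix extended by the identity\<close>

text \<open>The block diagonal matrix with blocks \<open>Q\<close> on \<open>C\<close> and the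
  identity off \<open>C\<close>; mixed pairs get 0 because their two vertices differ.\<close>

definition extend_id :: "'a set \<Rightarrow> ('a \<Rightarrow> 'a \<Rightarrow> complex) \<Rightarrow> 'a \<Rightarrow> 'a \<Rightarrow> complex" where
  "extend_id C Q v w = (if v \<in> C \<and> w \<in> C then Q v w else of_bool (v = w))"

lemma orthogonal_on_extend_id:
  assumes "finite V" "C \<subseteq> V" "orthogonal_on C Q"
  shows "orthogonal_on V (extend_id C Q)"
proof -
  have split: "sum h V = sum h C + sum h (V - C)" for h :: "'a \<Rightarrow> complex"
    using assms by (metis sum.subset_diff add.commute)
  have fin: "finite C" "finite (V - C)"
    using assms finite_subset by auto
  \<comment> \<open>Stated for arbitrary \<open>P\<close>, so that it serves for \<open>Q\<close>
    (rows) and for its transpose (columns).\<close>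
  have gen: "(\<Sum>u\<in>V. extend_id C P v u * extend_id C P w u) = of_bool (v = w)"
    if P: "\<And>v w. v \<in> C \<Longrightarrow> w \<in> C \<Longrightarrow> (\<Sum>u\<in>C. P v u * P w u) = of_bool (v = w)"
      and vw: "v \<in> V" "w \<in> V" for P v w
  proof -
    have "(\<Sum>u\<in>C. extend_id C P v u * extend_id C P w u) = of_bool (v \<in> C \<and> v = w)"
    proof (cases "v \<in> C \<and> w \<in> C")
      case True
      then show ?thesis using P by (simp add: extend_id_def)
    next
      case False
      then show ?thesis by (intro sum.neutral[THEN trans]) (auto simp: extend_id_def)
    qed
    moreover have "(\<Sum>u\<in>V - C. extend_id C P v u * extend_id C P w u)
        = (\<Sum>u\<in>V - C. if u = v then of_bool (v = w) else 0)"
      by (rule sum.cong) (auto simp: extend_id_def)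
    ultimately show ?thesis
      using vw fin by (auto simp: split)
  qed
  have "extend_id C Q u v = extend_id C (\<lambda>x y. Q y x) v u" for u v
    by (auto simp: extend_id_def)
  then show ?thesis
    using gen[of Q] gen[of "\<lambda>x y. Q y x"] assms(3) by (auto simp: orthogonal_on_def)
qed

text \<open>Rows suffice for the concrete matrices: these are square, and the column relations
  follow in \<open>orthogonal_on_mat_on\<close>.\<close>

definition orthonormal_rows :: "nat \<Rightarrow> complex mat \<Rightarrow> bool" where
  "orthonormal_rows n R \<longleftrightarrow> R \<in> carrier_mat n n \<and>
     (\<forall>i<n. \<forall>j<n. (\<Sum>l<n. R $$ (i, l) * R $$ (j, l)) = of_bool (i = j))"

text \<open>A one-sided inverse of a square matrix is two-sided, so \<open>R R^T = I\<close> also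
  yields \<open>R^T R = I\<close>.\<close>

lemma orthogonal_on_mat_on:
  assumes vs: "distinct vs" and orth: "orthonormal_rows (length vs) R"
  shows "orthogonal_on (set vs) (mat_on vs R)"
proof -
  let ?n = "length vs"
  have R: "R \<in> carrier_mat ?n ?n"
    and rows: "\<And>i j. i < ?n \<Longrightarrow> j < ?n \<Longrightarrow>
      (\<Sum>l<?n. R $$ (i, l) * R $$ (j, l)) = of_bool (i = j)"
    using orth by (auto simp: orthonormal_rows_def)
  have RR: "R * transpose_mat R = 1\<^sub>m ?n"
    by (rule eq_matI) (use R rows in \<open>auto simp: scalar_prod_def atLeast0LessThan\<close>)
  have RR': "transpose_mat R * R = 1\<^sub>m ?n"
    using mat_mult_left_right_inverse[OF R _ RR] R by simp
  have bij: "bij_betw ((!) vs) {..<?n} (set vs)"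
    using vs by (intro bij_betw_nth) auto
  have cols: "(\<Sum>l<?n. R $$ (l, i) * R $$ (l, j)) = of_bool (i = j)" if "i < ?n" "j < ?n" for i j
    using arg_cong[OF RR', of "\<lambda>A. A $$ (i, j)"] R that
    by (simp add: scalar_prod_def atLeast0LessThan of_bool_def)
  show ?thesis
    unfolding orthogonal_on_def all_set_conv_all_nth sum.reindex_bij_betw[OF bij, symmetric]
    using rows cols vs by (auto simp: mat_on_nth[OF vs] nth_eq_iff_index_eq)
qed

text \<open>The identity part forces the entries outside \<open>C\<close> to agree, and by symmetry of \<open>F\<close> they can
  be moved behind the entries in \<open>C\<close>; the prefix \<open>ps\<close> is there for the induction.\<close>

lemma transform_extend_id_prefix:
  fixes F :: "'a list \<Rightarrow> complex"
  assumes V: "finite V" "C \<subseteq> V" and F: "\<And>xs ys. mset xs = mset ys \<Longrightarrow> F xs = F ys"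
  shows "set xs \<subseteq> V \<Longrightarrow> vertex_transform V (extend_id C Q) (\<lambda>ys. F (ps @ ys)) xs =
    vertex_transform C Q (\<lambda>ys. F (ps @ ys @ filter (\<lambda>x. x \<notin> C) xs)) (filter (\<lambda>x. x \<in> C) xs)"
proof (induction xs arbitrary: ps)
  case Nil
  then show ?case by (simp add: vertex_transform_def)
next
  case (Cons x xs)
  \<comment> \<open>The vertex \<open>v\<close> chosen for the first slot joins the prefix, so that
    the induction hypothesis applies to \<open>xs\<close>.\<close>
  have "vertex_transform V (extend_id C Q) (\<lambda>ys. F (ps @ ys)) (x # xs) =
      (\<Sum>v\<in>V. extend_id C Q v x *
        vertex_transform V (extend_id C Q) (\<lambda>ys. F ((ps @ [v]) @ ys)) xs)"
    by (simp add: vertex_transform_def sum_tuples_Suc sum_distrib_left mult_ac)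
  also have "\<dots> = (\<Sum>v\<in>V. extend_id C Q v x * vertex_transform C Q
      (\<lambda>ys. F ((ps @ [v]) @ ys @ filter (\<lambda>x. x \<notin> C) xs)) (filter (\<lambda>x. x \<in> C) xs))"
    using Cons.prems by (intro sum.cong refl arg_cong2[where f = "(*)"] Cons.IH) simp
  also have "\<dots> = vertex_transform C Q
      (\<lambda>ys. F (ps @ ys @ filter (\<lambda>x. x \<notin> C) (x # xs))) (filter (\<lambda>x. x \<in> C) (x # xs))"
  proof (cases "x \<in> C")
    case True
    then have sel: "(\<Sum>v\<in>V. extend_id C Q v x * h v) = (\<Sum>v\<in>C. Q v x * h v)" for h
      by (intro sum.mono_neutral_cong_right) (use V in \<open>auto simp: extend_id_def\<close>)
    then show ?thesis
      unfolding sel using True by (simp add: vertex_transform_def sum_tuples_Suc sum_distrib_left mult_ac)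
  next
    case False
    then have "(\<Sum>v\<in>V. extend_id C Q v x * h v) = (\<Sum>v\<in>V. if v = x then h v else 0)" for h
      by (intro sum.cong) (auto simp: extend_id_def)
    then have sel: "(\<Sum>v\<in>V. extend_id C Q v x * h v) = h x" for h
      using V Cons.prems by simp
    \<comment> \<open>Column \<open>x\<close> is a unit vector, which forces \<open>v = x\<close>;
      symmetry moves this entry from the prefix to the tail of vertices outside
      \<open>C\<close>.\<close>
    have "F ((ps @ [x]) @ ys @ ds) = F (ps @ ys @ x # ds)" for ys ds
      by (rule F) simp
    then show ?thesis
      using False by (simp add: sel vertex_transform_def)
  qed
  finally show ?case .
qed

lemma vertex_tensor_mset_cong:
  "mset xs = mset ys \<Longrightarrow> vertex_tensor E xs = vertex_tensor E ys"
  by (metis vertex_tensor_def mset_eq_imp_distinct_iff set_mset_mset)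

lemma transform_extend_id:
  assumes "finite V" "C \<subseteq> V" "set xs \<subseteq> V"
  shows "vertex_transform V (extend_id C Q) (vertex_tensor E) xs =
    vertex_transform C Q (\<lambda>ys. vertex_tensor E (ys @ filter (\<lambda>x. x \<notin> C) xs))
      (filter (\<lambda>x. x \<in> C) xs)"
  using transform_extend_id_prefix[OF assms(1,2) vertex_tensor_mset_cong assms(3), where ps = "[]"]
  by simp


section \<open>Orthogonality of the five families\<close>

text \<open>Up to sign, \<open>R_gm\<close> and \<open>R_wqh\<close> are Householder reflections in a vector with entries \<open>\<plusminus>1\<close>.\<close>

lemma householder_orthonormal:
  fixes c :: complex
  assumes u: "\<And>l. u l * u l = 1" and c: "c * of_nat n = 2" and ij: "i < n" "j < n"
  shows "(\<Sum>l<n. (of_bool (i = l) - c * u i * u l) * (of_bool (j = l) - c * u j * u l))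
    = of_bool (i = j)"
proof -
  have "(of_bool (i = l) - c * u i * u l) * (of_bool (j = l) - c * u j * u l) =
      (if l = i then of_bool (i = j) - c * u i * u j else 0) - (if l = j then c * u i * u j else 0)
      + c * c * u i * u j" for l
  proof -
    have expand: "(a - x) * (b - y) = a * b - a * y - b * x + x * y" for a b x y :: complex
      by (simp add: algebra_simps)
    have "(c * u i * u l) * (c * u j * u l) = c * c * u i * u j * (u l * u l)"
      by (simp only: mult_ac)
    then have square: "(c * u i * u l) * (c * u j * u l) = c * c * u i * u j"
      by (simp only: u mult_1_right)
    show ?thesis
      unfolding expand square by (cases "l = i"; cases "l = j") (simp_all add: mult_ac)
  qed
  \<comment> \<open>Two cross terms \<open>- c * u i * u j\<close> meet the constant term summed
    \<open>n\<close> times; they cancel because \<open>c * n = 2\<close>.\<close>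
  then have "(\<Sum>l<n. (of_bool (i = l) - c * u i * u l) * (of_bool (j = l) - c * u j * u l))
      = of_bool (i = j) - c * u i * u j - c * u i * u j + (c * of_nat n) * (c * u i * u j)"
    using ij by (simp add: sum.distrib sum_subtractf mult_ac)
  then show ?thesis
    unfolding c by simp
qed

lemma R_gm_orthonormal:
  assumes "n > 0"
  shows "orthonormal_rows n (R_gm n)"
proof -
  \<comment> \<open>\<open>R_gm\<close> is the negative of the reflection in the all-ones vector.
    The factors 1 stand for \<open>u i\<close> and \<open>u l\<close>, and the signs cancel in
    products of two entries.\<close>
  have entry: "R_gm n $$ (i, l) = - (of_bool (i = l) - 2 / of_nat n * 1 * 1)"
    if "i < n" "l < n" for i l
    using that by (simp add: R_gm_def ones_mat_def)
  have "(\<Sum>l<n. R_gm n $$ (i, l) * R_gm n $$ (j, l)) = of_bool (i = j)" if "i < n" "j < n" for i j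
  proof -
    have "(\<Sum>l<n. R_gm n $$ (i, l) * R_gm n $$ (j, l)) =
        (\<Sum>l<n. (of_bool (i = l) - 2 / of_nat n * 1 * 1) * (of_bool (j = l) - 2 / of_nat n * 1 * 1))"
      by (intro sum.cong refl) (use that in \<open>simp only: entry lessThan_iff minus_mult_minus\<close>)
    also have "\<dots> = of_bool (i = j)"
      by (rule householder_orthonormal) (use that assms in auto)
    finally show ?thesis .
  qed
  moreover have "R_gm n \<in> carrier_mat n n"
    by (intro carrier_matI) (simp_all add: R_gm_def ones_mat_def)
  ultimately show ?thesis
    by (simp add: orthonormal_rows_def)
qed

lemma R_wqh_orthonormal:
  assumes "p > 0"
  shows "orthonormal_rows (2 * p) (R_wqh p)"
proof -
  \<comment> \<open>The reflecting vector is 1 on the first half and -1 on the second;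
    \<open>c = 1 / p\<close> because the dimension is \<open>2 * p\<close>.\<close>
  define u :: "nat \<Rightarrow> complex" where "u i = (if i < p then 1 else -1)" for i
  have entry: "R_wqh p $$ (i, l) = of_bool (i = l) - 1 / of_nat p * u i * u l"
    if "i < 2 * p" "l < 2 * p" for i l
    using that by (auto simp: R_wqh_def Let_def ones_mat_def u_def)
  have "(\<Sum>l<2 * p. R_wqh p $$ (i, l) * R_wqh p $$ (j, l)) = of_bool (i = j)"
    if "i < 2 * p" "j < 2 * p" for i j
  proof -
    have "(\<Sum>l<2 * p. R_wqh p $$ (i, l) * R_wqh p $$ (j, l)) = (\<Sum>l<2 * p.
        (of_bool (i = l) - 1 / of_nat p * u i * u l) * (of_bool (j = l) - 1 / of_nat p * u j * u l))"
      by (intro sum.cong refl) (use that in \<open>simp only: entry lessThan_iff\<close>)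
    also have "\<dots> = of_bool (i = j)"
      by (rule householder_orthonormal) (use that assms in \<open>auto simp: u_def\<close>)
    finally show ?thesis .
  qed
  moreover have "R_wqh p \<in> carrier_mat (2 * p) (2 * p)"
    by (auto simp: R_wqh_def Let_def ones_mat_def)
  ultimately show ?thesis
    by (simp add: orthonormal_rows_def)
qed

text \<open>Splitting off the factor 1/2 leaves, in the applications, an integer matrix
  \<open>M\<close> with rows of squared length 4. The quantifiers range over \<open>{..<n}\<close>
  so that this set can be replaced by an explicit enumeration and the check evaluated.\<close>

lemma orthonormal_rows_halfI:
  assumes "R \<in> carrier_mat n n"
    and entry: "\<forall>i\<in>{..<n}. \<forall>j\<in>{..<n}. R $$ (i, j) = M i j / 2"
    and rows: "\<forall>i\<in>{..<n}. \<forall>j\<in>{..<n}. (\<Sum>l\<in>{..<n}. M i l * M j l) = 4 * of_bool (i = j)"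
  shows "orthonormal_rows n R"
proof -
  have "(\<Sum>l<n. R $$ (i, l) * R $$ (j, l)) = of_bool (i = j)" if "i < n" "j < n" for i j
  proof -
    have "(\<Sum>l<n. R $$ (i, l) * R $$ (j, l)) = (\<Sum>l<n. M i l * M j l) / 4"
      unfolding sum_divide_distrib by (rule sum.cong) (use that in \<open>simp_all add: entry[rule_format]\<close>)
    then show ?thesis using rows that by simp
  qed
  then show ?thesis using assms(1) by (simp add: orthonormal_rows_def)
qed

lemma R_f_orthonormal: "orthonormal_rows 7 R_f"
proof (rule orthonormal_rows_halfI)
  have less_7: "{..<7} = {0, 1, 2, 3, 4, 5, 6 :: nat}" by auto
  let ?M = "circulant_entry [-1, 1, 1, 0, 1, 0, 0 :: complex]"
  show "R_f \<in> carrier_mat 7 7"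
    by (intro carrier_matI) (simp_all add: R_f_def circulant_def)
  show "\<forall>i\<in>{..<7}. \<forall>j\<in>{..<7}. R_f $$ (i, j) = ?M i j / 2"
    by (simp add: R_f_def circulant_def)
  show "\<forall>i\<in>{..<7}. \<forall>j\<in>{..<7}. (\<Sum>l\<in>{..<7}. ?M i l * ?M j l) = 4 * of_bool (i = j)"
    unfolding less_7 by (simp add: circulant_entry_def)
qed

lemma R_c_orthonormal: "orthonormal_rows 8 R_c"
proof (rule orthonormal_rows_halfI)
  have less_8: "{..<8} = {0, 1, 2, 3, 4, 5, 6, 7 :: nat}" by auto
  \<comment> \<open>The matrix \<open>2 R_c\<close> with its 2 x 2 blocks written out.\<close>
  let ?M = "\<lambda>i j. [[-1, 0, 1, 0, 1, 0, 1, 0],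
    [0, -1, 0, 1, 0, 1, 0, 1],
    [1, 0, 0, -1, 1, 0, 0, 1],
    [0, 1, -1, 0, 0, 1, 1, 0],
    [1, 0, 0, 1, 0, -1, 1, 0],
    [0, 1, 1, 0, -1, 0, 0, 1],
    [1, 0, 1, 0, 0, 1, 0, -1],
    [0, 1, 0, 1, 1, 0, -1, 0 :: complex]] ! i ! j"
  show "R_c \<in> carrier_mat 8 8"
    by (simp add: R_c_def block_mat_def)
  show "\<forall>i\<in>{..<8}. \<forall>j\<in>{..<8}. R_c $$ (i, j) = ?M i j / 2"
    unfolding less_8 by (simp add: R_c_def block_mat_def Z_mat_def ones_mat_def)
  show "\<forall>i\<in>{..<8}. \<forall>j\<in>{..<8}. (\<Sum>l\<in>{..<8}. ?M i l * ?M j l) = 4 * of_bool (i = j)"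
    unfolding less_8 by simp
qed

lemma sum_lessThan_double: "sum f {..<2 * m} = (\<Sum>b<m. f (2 * b) + f (2 * b + 1))"
  for f :: "nat \<Rightarrow> complex"
  by (induction m) (simp_all add: add.assoc)

text \<open>Both indices are below \<open>m\<close>, so the difference wraps around at most
  once.\<close>

lemma circulant_entry_nth:
  assumes "length Cs = m" "a < m" "b < m"
  shows "circulant_entry Cs a b = Cs ! (if a \<le> b then b - a else m + b - a)"
proof -
  have "(int b - int a) mod int m = int (if a \<le> b then b - a else m + b - a)"
  proof (cases "a \<le> b")
    case True
    then show ?thesis using assms by (simp add: of_nat_diff)
  next
    case False
    have "(int b - int a) mod int m = (int b - int a + int m) mod int m"
      by simp
    also have "\<dots> = int b - int a + int m"
      by (rule mod_pos_pos_trivial) (use False assms in auto)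
    finally show ?thesis
      using assms False by (simp add: of_nat_diff)
  qed
  then show ?thesis
    unfolding circulant_entry_def assms(1) by simp
qed

text \<open>Block row \<open>a\<close> of \<open>2 R_sg\<close> holds \<open>J\<close> in block
  column \<open>a\<close> and \<open>Y\<close> in the cyclically preceding one. The rows are
  orthonormal since \<open>J Y^T = 0\<close>, \<open>J J^T + Y Y^T = 4 I\<close>, and distinct block
  rows have their \<open>Y\<close> in distinct columns.\<close>

lemma R_sg_orthonormal:
  assumes "even n" "n \<ge> 4"
  shows "orthonormal_rows n (R_sg n)"
proof -
  obtain m where n: "n = 2 * m" and m: "m \<ge> 2"
    using assms by (auto elim!: evenE)
  define Cs where "Cs = [ones_mat 2] @ replicate (m - 2) (0\<^sub>m 2 2) @ [Y_mat]"
  \<comment> \<open>\<open>pre a\<close> is the block column of \<open>Y\<close> in block row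
    \<open>a\<close>; it differs from \<open>a\<close> because \<open>m \<ge> 2\<close>.\<close>
  define pre where "pre a = (if a = 0 then m - 1 else a - 1)" for a
  define y :: "nat \<Rightarrow> nat \<Rightarrow> complex" where "y p q = (if p = q then 1 else -1)" for p q
  have len: "length Cs = m"
    using m by (simp add: Cs_def)
  have R_sg: "R_sg (2 * m) = (1 / 2) \<cdot>\<^sub>m block_circulant 2 Cs"
    by (simp add: R_sg_def Cs_def n)
  have Cs_nth: "Cs ! d = (if d = 0 then ones_mat 2 else if d = m - 1 then Y_mat else 0\<^sub>m 2 2)"
    if "d < m" for d
    using that m by (auto simp: Cs_def nth_append nth_Cons')
  have pre_inj: "pre a = pre a' \<longleftrightarrow> a = a'" if "a < m" "a' < m" for a a'
    using that unfolding pre_def by (cases a; cases a') auto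
  have block: "circulant_entry Cs a b $$ (p, q) = of_bool (a = b) + of_bool (b = pre a) * y p q"
    if "a < m" "b < m" "p < 2" "q < 2" for a b p q
    using that m
    by (auto simp: circulant_entry_nth[OF len] Cs_nth pre_def y_def Y_mat_def ones_mat_def)
  have entry: "R_sg n $$ (i, 2 * b + q) =
      (of_bool (i div 2 = b) + of_bool (b = pre (i div 2)) * y (i mod 2) q) / 2"
    if "i < n" "b < m" "q < 2" for i b q
  proof -
    have "R_sg n $$ (i, 2 * b + q) = circulant_entry Cs (i div 2) b $$ (i mod 2, q) / 2"
      using that by (simp add: R_sg block_circulant_def block_mat_def n len)
    then show ?thesis
      using that n by (simp add: block)
  qed
  have "(\<Sum>l<n. R_sg n $$ (i, l) * R_sg n $$ (j, l)) = of_bool (i = j)" if ij: "i < n" "j < n" for i j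
  proof -
    let ?a = "i div 2" and ?p = "i mod 2" and ?a' = "j div 2" and ?p' = "j mod 2"
    have ij_iff: "i = j \<longleftrightarrow> ?a = ?a' \<and> ?p = ?p'"
      by (metis div_mult_mod_eq)
    have am: "?a < m" "?a' < m"
      using ij n by auto
    have "(\<Sum>l<n. R_sg n $$ (i, l) * R_sg n $$ (j, l)) =
        (\<Sum>b<m. (of_bool (?a = b) * of_bool (?a' = b) +
          y ?p ?p' * (of_bool (b = pre ?a) * of_bool (b = pre ?a'))) / 2)"
      unfolding n sum_lessThan_double
    proof (intro sum.cong refl)
      fix b assume b: "b \<in> {..<m}"
      have flip: "y (h mod 2) 1 = - y (h mod 2) 0" for h
        by (simp add: y_def)
      have prod: "y ?p ?p' = y ?p 0 * y ?p' 0"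
        by (auto simp: y_def)
      have vals: "R_sg (2 * m) $$ (h, 2 * b) =
            (of_bool (h div 2 = b) + of_bool (b = pre (h div 2)) * y (h mod 2) 0) / 2"
          "R_sg (2 * m) $$ (h, 2 * b + 1) =
            (of_bool (h div 2 = b) + of_bool (b = pre (h div 2)) * - y (h mod 2) 0) / 2"
        if "h < n" for h
        using entry[OF that, of b 0] entry[OF that, of b 1] b unfolding n flip by simp_all
      \<comment> \<open>The mixed products of \<open>J\<close> and \<open>Y\<close> cancel, since
        the two entries in a row of \<open>Y\<close> have opposite signs.\<close>
      have combine: "(A + B * e) / 2 * ((A' + B' * e') / 2) + (A + B * - e) / 2 * ((A' + B' * - e') / 2)
          = (A * A' + e * e' * (B * B')) / 2" for A B A' B' e e' :: complex
        by (simp add: field_simps)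
      show "R_sg (2 * m) $$ (i, 2 * b) * R_sg (2 * m) $$ (j, 2 * b) +
          R_sg (2 * m) $$ (i, 2 * b + 1) * R_sg (2 * m) $$ (j, 2 * b + 1) =
          (of_bool (?a = b) * of_bool (?a' = b) +
          y ?p ?p' * (of_bool (b = pre ?a) * of_bool (b = pre ?a'))) / 2"
        unfolding vals[OF ij(1)] vals[OF ij(2)] prod by (rule combine)
    qed
    also have "\<dots> = ((\<Sum>b<m. of_bool (?a = b) * of_bool (?a' = b)) +
        y ?p ?p' * (\<Sum>b<m. of_bool (b = pre ?a) * of_bool (b = pre ?a'))) / 2"
      by (simp only: sum_divide_distrib[symmetric] sum.distrib sum_distrib_left)
    also have "(\<Sum>b<m. of_bool (?a = b) * of_bool (?a' = b) :: complex) =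
        (\<Sum>b<m. if b = ?a then of_bool (?a = ?a') else 0)"
      by (rule sum.cong) auto
    also have "\<dots> = of_bool (?a = ?a')"
      using am by simp
    also have "(\<Sum>b<m. of_bool (b = pre ?a) * of_bool (b = pre ?a') :: complex) =
        (\<Sum>b<m. if b = pre ?a then of_bool (pre ?a = pre ?a') else 0)"
      by (rule sum.cong) auto
    also have "\<dots> = of_bool (pre ?a = pre ?a')"
      using am by (auto simp: pre_def)
    also have "pre ?a = pre ?a' \<longleftrightarrow> ?a = ?a'"
      by (rule pre_inj[OF am])
    \<comment> \<open>Within one block row, \<open>(1 + y p p') / 2\<close> is 1 for
      \<open>p = p'\<close> and 0 otherwise.\<close>
    also have "(of_bool (?a = ?a') + y ?p ?p' * of_bool (?a = ?a')) / 2 = (of_bool (i = j) :: complex)"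
      using ij_iff by (auto simp: y_def)
    finally show ?thesis .
  qed
  moreover have "R_sg n \<in> carrier_mat n n"
    by (simp add: R_sg block_circulant_def block_mat_def n len)
  ultimately show ?thesis
    by (simp add: orthonormal_rows_def)
qed


section \<open>Switching as a similarity\<close>

text \<open>As \<open>C\<close> and \<open>D\<close> are disjoint, \<open>e \<union> A\<close>
  determines \<open>e\<close> and \<open>A\<close>, and then \<open>r = card e\<close>; so a single
  member of the family decides. Applied to the removed and to the added edges.\<close>

lemma mem_union_family_iff:
  assumes "C \<inter> D = {}"
    and M: "\<And>r A. r \<in> {1..k} \<Longrightarrow> A \<in> nsets D (k - r) \<Longrightarrow> M r A \<subseteq> nsets C r"
    and eA: "e \<subseteq> C" "A \<subseteq> D"
  shows "e \<union> A \<in> (\<Union>r\<in>{1..k}. \<Union>A\<in>nsets D (k - r). {e \<union> A |e. e \<in> M r A}) \<longleftrightarrow>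
    card e \<in> {1..k} \<and> A \<in> nsets D (k - card e) \<and> e \<in> M (card e) A"
proof
  assume "e \<union> A \<in> (\<Union>r\<in>{1..k}. \<Union>A\<in>nsets D (k - r). {e \<union> A |e. e \<in> M r A})"
  then obtain r B f where rB: "r \<in> {1..k}" "B \<in> nsets D (k - r)" and f: "f \<in> M r B"
    and eq: "e \<union> A = f \<union> B"
    by auto
  have "f \<in> nsets C r"
    using M[OF rB] f by auto
  then have "f \<subseteq> C" "card f = r" "B \<subseteq> D"
    using rB by (auto simp: nsets_def)
  with eq eA assms(1) have "e = f" "A = B"
    by blast+
  with \<open>card f = r\<close> rB f show "card e \<in> {1..k} \<and> A \<in> nsets D (k - card e) \<and> e \<in> M (card e) A"
    by simp
qed blast

text \<open>With the part \<open>zs\<close> in \<open>D\<close> fixed, the tensor of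
  \<open>E\<close> restricts to that of the link \<open>M\<close>; a repetition in \<open>ys\<close>
  makes both sides 0.\<close>

lemma vertex_tensor_append:
  assumes "C \<inter> D = {}" "distinct zs" "set zs \<subseteq> D" "ys \<in> tuples C r"
    and "\<And>e. e \<in> nsets C r \<Longrightarrow> e \<union> set zs \<in> E \<longleftrightarrow> e \<in> M"
  shows "vertex_tensor E (ys @ zs) = vertex_tensor M ys"
proof (cases "distinct ys")
  case True
  then have "set ys \<in> nsets C r"
    using assms(4) distinct_card by (force simp: tuples_def nsets_def)
  moreover have "distinct (ys @ zs)"
    using True assms by (auto simp: tuples_def)
  ultimately show ?thesis
    using True assms(5) by (simp add: vertex_tensor_def)
qed (simp add: vertex_tensor_def)

theorem theorem5p1:
  fixes R :: "complex mat" and s k :: nat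
    and V C D :: "'a set" and vs :: "'a list" and E H :: "'a set set"
    and L :: "nat \<Rightarrow> 'a set \<Rightarrow> 'a set set"
  assumes R: "even s \<and> s \<ge> 4 \<and> R = R_gm s
            \<or> even s \<and> s \<ge> 4 \<and> R = R_sg s
            \<or> s = 7 \<and> R = R_f
            \<or> s = 8 \<and> R = R_c
            \<or> (\<exists>p\<ge>1. s = 2 * p \<and> R = R_wqh p)"
    and k: "k \<ge> 2"
    and G: "uniform_hypergraph k V E"
    and C: "C \<subseteq> V" "card C = s" "vs \<in> permutations_of_set C"
    and D: "D = V - C"
    and L: "\<And>r A. r \<in> {1..k} \<Longrightarrow> A \<in> nsets D (k - r) \<Longrightarrow>
              L r A \<in> switchable R vs r \<and>
              {e \<union> A |e. e \<in> nsets C r \<and> e \<union> A \<in> E} = {e \<union> A |e. e \<in> L r A}"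
    and H: "H = switched_edges R vs k D L E"
  shows "uniform_hypergraph k V H \<and> E_cospectral k V E V H"
proof
  have vs: "distinct vs" "set vs = C" "length vs = s"
    using C by (auto simp: permutations_of_set_def simp flip: distinct_card)
  have V: "finite V" "E \<subseteq> nsets V k"
    using G by (auto simp: uniform_hypergraph_def)
  have CD: "C \<inter> D = {}" "D \<subseteq> V"
    using D by auto
  let ?S = "\<lambda>r A. switched R vs r (L r A)"
  have L_sub: "L r A \<subseteq> nsets C r" and S_sub: "?S r A \<subseteq> nsets C r"
    and S_switch: "switches_to R vs r (L r A) (?S r A)"
    if "r \<in> {1..k}" "A \<in> nsets D (k - r)" for r A
    using L[OF that] switched_switchable[OF vs(1), of "L r A" R r] vs
    by (auto simp: switchable_def uniform_hypergraph_def)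
  have E_iff: "e \<union> A \<in> E \<longleftrightarrow> e \<in> L r A"
    if rA: "r \<in> {1..k}" "A \<in> nsets D (k - r)" and e: "e \<in> nsets C r" for r A e
  proof -
    \<comment> \<open>Disjointness of \<open>C\<close> and \<open>D\<close> lets \<open>A\<close> be
      cancelled, which turns the equality of families into a statement about a single
      \<open>e\<close>.\<close>
    have cancel: "f = e" if "f \<in> nsets C r" "f \<union> A = e \<union> A" for f
      using that rA e CD by (fastforce simp: nsets_def)
    have "e \<union> A \<in> E \<longleftrightarrow> e \<union> A \<in> {e \<union> A |e. e \<in> nsets C r \<and> e \<union> A \<in> E}"
      using e by auto
    also have "\<dots> \<longleftrightarrow> e \<union> A \<in> {e \<union> A |e. e \<in> L r A}"
      using L[OF rA] by simp
    also have "\<dots> \<longleftrightarrow> e \<in> L r A"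
      using cancel L_sub[OF rA] by auto
    finally show ?thesis .
  qed
  define removed where "removed = (\<Union>r\<in>{1..k}. \<Union>A\<in>nsets D (k - r). {e \<union> A |e. e \<in> L r A})"
  define added where "added = (\<Union>r\<in>{1..k}. \<Union>A\<in>nsets D (k - r). {e \<union> A |e. e \<in> ?S r A})"
  have H_eq: "H = (E - removed) \<union> added"
    by (simp only: H switched_edges_def removed_def added_def)
  have removed_iff: "e \<union> A \<in> removed \<longleftrightarrow>
      card e \<in> {1..k} \<and> A \<in> nsets D (k - card e) \<and> e \<in> L (card e) A"
    if "e \<subseteq> C" "A \<subseteq> D" for e A
    unfolding removed_def using CD(1) L_sub that by (rule mem_union_family_iff)
  have added_iff: "e \<union> A \<in> added \<longleftrightarrow>
      card e \<in> {1..k} \<and> A \<in> nsets D (k - card e) \<and> e \<in> ?S (card e) A"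
    if "e \<subseteq> C" "A \<subseteq> D" for e A
    unfolding added_def using CD(1) S_sub that by (rule mem_union_family_iff)
  \<comment> \<open>By \<open>E_iff\<close>, all edges of \<open>G\<close> of type
    \<open>(r, A)\<close> are removed, so exactly the added ones remain.\<close>
  have H_iff: "e \<union> A \<in> H \<longleftrightarrow> e \<in> ?S r A"
    if rA: "r \<in> {1..k}" "A \<in> nsets D (k - r)" and e: "e \<in> nsets C r" for r A e
  proof -
    have eA: "e \<subseteq> C" "A \<subseteq> D" "card e = r"
      using rA e by (auto simp: nsets_def)
    show ?thesis
      using E_iff[OF that] removed_iff[OF eA(1,2)] added_iff[OF eA(1,2)] rA eA(3)
      by (simp add: H_eq)
  qed
  \<comment> \<open>The \<open>C\<close> part is \<open>{}\<close>, of cardinality 0 outside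
    \<open>{1..k}\<close>, so nothing inside \<open>D\<close> is removed or added.\<close>
  have H_iff_D: "A \<in> H \<longleftrightarrow> A \<in> E" if "A \<subseteq> D" for A
    using removed_iff[of "{}" A] added_iff[of "{}" A] that by (simp add: H_eq)
  have "e \<union> A \<in> nsets V k" if "r \<in> {1..k}" "A \<in> nsets D (k - r)" "e \<in> nsets C r" for r A e
  proof -
    have "card (e \<union> A) = card e + card A"
      by (rule card_Un_disjoint) (use that CD in \<open>auto simp: nsets_def\<close>)
    then show ?thesis
      using that C CD by (auto simp: nsets_def)
  qed
  then show "uniform_hypergraph k V H"
    using V S_sub by (fastforce simp: H_eq added_def uniform_hypergraph_def)

  \<comment> \<open>The case distinction on the shape of \<open>R\<close> enters at this point
    only.\<close>
  have "orthonormal_rows s R"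
    using R R_gm_orthonormal R_sg_orthonormal R_f_orthonormal R_c_orthonormal R_wqh_orthonormal
    by auto
  then have Q: "orthogonal_on C (mat_on vs R)"
    using orthogonal_on_mat_on[OF vs(1)] vs by simp
  have "vertex_tensor H xs = vertex_transform V (extend_id C (mat_on vs R)) (vertex_tensor E) xs"
    if xs: "xs \<in> tuples V k" for xs
  proof -
    \<comment> \<open>The tuple is sorted into its \<open>C\<close> part and its \<open>D\<close>
      part, as the symmetry of the adjacency tensor permits.\<close>
    define ys where "ys = filter (\<lambda>x. x \<in> C) xs"
    define zs where "zs = filter (\<lambda>x. x \<notin> C) xs"
    have "mset xs = mset (ys @ zs)"
      by (simp add: ys_def zs_def)
    then have H_xs: "vertex_tensor H xs = vertex_tensor H (ys @ zs)"
      by (rule vertex_tensor_mset_cong)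
    have len: "length ys + length zs = k" and zs_D: "set zs \<subseteq> D" and ys_C: "set ys \<subseteq> C"
      using xs sum_length_filter_compl[of "\<lambda>x. x \<in> C" xs] D
      by (auto simp: ys_def zs_def tuples_def)
    have "vertex_transform V (extend_id C (mat_on vs R)) (vertex_tensor E) xs =
        vertex_transform C (mat_on vs R) (\<lambda>us. vertex_tensor E (us @ zs)) ys"
      unfolding ys_def zs_def by (rule transform_extend_id) (use V C xs in \<open>auto simp: tuples_def\<close>)
    also have "\<dots> = vertex_tensor H (ys @ zs)"
    proof -
      \<comment> \<open>The assumption on \<open>L\<close> speaks of \<open>r \<ge> 1\<close> and of
        sets \<open>A\<close> with exactly \<open>k - r\<close> elements. For empty
        \<open>ys\<close> the tuple lies in \<open>D\<close>, where \<open>H\<close> and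
        \<open>E\<close> agree; a repetition in \<open>zs\<close> makes both sides 0.\<close>
      consider "ys = []" | "\<not> distinct zs" | "ys \<noteq> []" "distinct zs" by blast
      then show ?thesis
      proof cases
        case 1
        then show ?thesis
          using H_iff_D[OF zs_D] by (simp add: vertex_transform_def vertex_tensor_def)
      next
        case 2
        then show ?thesis
          by (simp add: vertex_transform_def vertex_tensor_def)
      next
        case 3
        let ?r = "length ys"
        have r: "?r \<in> {1..k}" "set zs \<in> nsets D (k - ?r)"
          using 3 len zs_D by (auto simp: nsets_def distinct_card Suc_le_eq)
        \<comment> \<open>With tail \<open>zs\<close> only the link \<open>L ?r (set zs)\<close> is
          visible, and its transform is the tensor of the switched link.\<close>
        have "vertex_transform C (mat_on vs R) (\<lambda>us. vertex_tensor E (us @ zs)) ys =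
            vertex_transform C (mat_on vs R) (vertex_tensor (L ?r (set zs))) ys"
          unfolding vertex_transform_def
          by (intro sum.cong refl arg_cong2[where f = "(*)"]
              vertex_tensor_append[OF CD(1) 3(2) zs_D] E_iff[OF r])
        also have "\<dots> = vertex_tensor (?S ?r (set zs)) ys"
          using S_switch[OF r] ys_C by (auto simp: switches_to_iff[OF vs(1)] vs tuples_def)
        also have "\<dots> = vertex_tensor H (ys @ zs)"
          by (rule sym, rule vertex_tensor_append[OF CD(1) 3(2) zs_D])
            (use ys_C H_iff[OF r] in \<open>auto simp: tuples_def\<close>)
        finally show ?thesis .
      qed
    qed
    finally show ?thesis using H_xs by simp
  qed
  then show "E_cospectral k V E V H"
    using k by (intro E_cospectralI vertex_eigenvalue_transform[OF V(1)
        orthogonal_on_extend_id[OF V(1) C(1) Q]]) auto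
qed

end
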